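(* Let $\Gamma$ be a finite simplicial graph with at least one vertex. The automorphism group $\mathrm{Aut}(A_\Gamma)$ of the right-angled Artin group $A_\Gamma$ has a non-trivial finite normal subgroup if and only if $\Gamma$ is a clique.
   Context: For a finite simplicial graph $\Gamma$ with vertex set $V(\Gamma)$ and edge set $E(\Gamma)$, the right-angled Artin group is $A_\Gamma=\langle V(\Gamma)\mid vw=wv \text{ whenever } \{v,w\}\in E(\Gamma)\rangle$. A clique is a complete graph (so that $A_\Gamma\cong\mathbb{Z}^{n}$ with $n=|V(\Gamma)|\geq 1$). *)

theory Defs
  imports "HOL-Algebra.Coset" "HOL-Algebra.Bij" "HOL-Library.Ramsey"
begin

section \<open>Groups given by generators and relations\<close>

text \<open>A letter \<open>(x, True)\<close> stands for the generator \<open>x\<close>, and \<open>(x, False)\<close> for its formal inverse.\<close>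

type_synonym 'a word = "('a \<times> bool) list"

definition words :: "'a set \<Rightarrow> 'a word set" where
  "words X = lists (X \<times> UNIV)"

text \<open>The pair \<open>(l, r)\<close> in \<open>R\<close> encodes the defining relation \<open>l = r\<close>.\<close>

inductive_set pres_rel :: "'a set \<Rightarrow> ('a word \<times> 'a word) set \<Rightarrow> ('a word \<times> 'a word) set"
  for X R where
    refl: "w \<in> words X \<Longrightarrow> (w, w) \<in> pres_rel X R"
  | sym: "(v, w) \<in> pres_rel X R \<Longrightarrow> (w, v) \<in> pres_rel X R"
  | trans: "(u, v) \<in> pres_rel X R \<Longrightarrow> (v, w) \<in> pres_rel X R \<Longrightarrow> (u, w) \<in> pres_rel X R"
  | cancel: "u \<in> words X \<Longrightarrow> v \<in> words X \<Longrightarrow> x \<in> X \<Longrightarrow>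
      (u @ [(x, b), (x, \<not> b)] @ v, u @ v) \<in> pres_rel X R"
  | relation: "u \<in> words X \<Longrightarrow> v \<in> words X \<Longrightarrow> l \<in> words X \<Longrightarrow> r \<in> words X \<Longrightarrow> (l, r) \<in> R \<Longrightarrow>
      (u @ l @ v, u @ r @ v) \<in> pres_rel X R"

definition presented_group ::
  "'a set \<Rightarrow> ('a word \<times> 'a word) set \<Rightarrow> 'a word set monoid" where
  "presented_group X R =
    \<lparr>carrier = words X // pres_rel X R,
     mult = \<lambda>A B. pres_rel X R `` {a @ b | a b. a \<in> A \<and> b \<in> B},
     one = pres_rel X R `` {[]}\<rparr>"

definition raag :: "'a set \<Rightarrow> 'a set set \<Rightarrow> 'a word set monoid" where
  "raag V E = presented_group V
     {([(v, True), (w, True)], [(w, True), (v, True)]) | v w. {v, w} \<in> E}"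


section \<open>Basic facts\<close>

lemma words_append [simp]: "u @ v \<in> words X \<longleftrightarrow> u \<in> words X \<and> v \<in> words X"
  by (simp add: words_def)

lemma words_Nil [simp]: "[] \<in> words X"
  by (simp add: words_def)

lemma words_Cons [simp]: "(x, b) # w \<in> words X \<longleftrightarrow> x \<in> X \<and> w \<in> words X"
  by (simp add: words_def)

lemma pres_rel_words: "(u, v) \<in> pres_rel X R \<Longrightarrow> u \<in> words X \<and> v \<in> words X"
  by (induction rule: pres_rel.induct) auto

lemma equiv_pres_rel: "equiv (words X) (pres_rel X R)"
  by (rule equivI)
    (auto simp: refl_on_def sym_on_def trans_on_def dest: pres_rel_words
      intro: pres_rel.refl pres_rel.sym pres_rel.trans)

lemma pres_rel_context:
  assumes "(u, v) \<in> pres_rel X R" "p \<in> words X" "q \<in> words X"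
  shows "(p @ u @ q, p @ v @ q) \<in> pres_rel X R"
  using assms
proof (induction rule: pres_rel.induct)
  case (cancel u v x b)
  then show ?case
    using pres_rel.cancel[of "p @ u" X "v @ q" x b R] by simp
next
  case (relation u v l r)
  then show ?case
    using pres_rel.relation[of "p @ u" X "v @ q" l r R] by simp
qed (auto intro: pres_rel.refl pres_rel.sym pres_rel.trans)

lemma pres_rel_append:
  assumes "(u, u') \<in> pres_rel X R" "(v, v') \<in> pres_rel X R"
  shows "(u @ v, u' @ v') \<in> pres_rel X R"
  using pres_rel_context[OF assms(1), of "[]" v] pres_rel_context[OF assms(2), of u' "[]"]
    pres_rel_words[OF assms(1)] pres_rel_words[OF assms(2)]
  by (auto intro: pres_rel.trans)

lemma presented_group_mult:
  assumes "u \<in> words X" "v \<in> words X"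
  shows "pres_rel X R `` {u} \<otimes>\<^bsub>presented_group X R\<^esub> pres_rel X R `` {v} = pres_rel X R `` {u @ v}"
  using assms
  by (auto simp: presented_group_def
      intro: pres_rel.trans pres_rel.sym pres_rel.refl pres_rel_append)

lemma presented_group_carrier:
  "A \<in> carrier (presented_group X R) \<longleftrightarrow> (\<exists>u \<in> words X. A = pres_rel X R `` {u})"
  by (auto simp: presented_group_def quotient_def)

lemma pres_rel_class_eq:
  assumes "(u, v) \<in> pres_rel X R"
  shows "pres_rel X R `` {u} = pres_rel X R `` {v}"
  using equiv_class_eq[OF equiv_pres_rel assms] .

lemma pres_rel_inverse:
  assumes "u \<in> words X"
  shows "\<exists>v \<in> words X. (v @ u, []) \<in> pres_rel X R"
  using assms
proof (induction u)
  case Nil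
  show ?case by (auto intro!: bexI[of _ "[]"] pres_rel.refl)
next
  case (Cons a u)
  obtain x b where a: "a = (x, b)" by (cases a)
  with Cons obtain v where v: "v \<in> words X" "(v @ u, []) \<in> pres_rel X R" by auto
  have "(v @ [(x, \<not> b), (x, b)] @ u, v @ u) \<in> pres_rel X R"
    using pres_rel.cancel[of v X u x "\<not> b" R] v a Cons.prems by simp
  with v a Cons.prems show ?case
    by (auto intro!: bexI[of _ "v @ [(x, \<not> b)]"] intro: pres_rel.trans)
qed

theorem group_presented_group: "group (presented_group X R)"
proof (rule groupI)
  show "\<one>\<^bsub>presented_group X R\<^esub> \<in> carrier (presented_group X R)"
    by (auto simp: presented_group_def quotient_def)
next
  fix A assume "A \<in> carrier (presented_group X R)"
  then obtain u where u: "u \<in> words X" "A = pres_rel X R `` {u}"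
    by (auto simp: presented_group_carrier)
  have one: "\<one>\<^bsub>presented_group X R\<^esub> = pres_rel X R `` {[]}"
    by (simp add: presented_group_def)
  show "\<one>\<^bsub>presented_group X R\<^esub> \<otimes>\<^bsub>presented_group X R\<^esub> A = A"
    using u by (simp add: one presented_group_mult)
  obtain v where "v \<in> words X" "(v @ u, []) \<in> pres_rel X R"
    using pres_rel_inverse u by blast
  then show "\<exists>B \<in> carrier (presented_group X R).
      B \<otimes>\<^bsub>presented_group X R\<^esub> A = \<one>\<^bsub>presented_group X R\<^esub>"
    using u by (intro bexI[of _ "pres_rel X R `` {v}"])
      (auto simp: one presented_group_mult presented_group_carrier simp del: Image_singleton_iff
        intro!: pres_rel_class_eq)
qed (auto simp: presented_group_carrier presented_group_mult)

corollary group_raag: "group (raag V E)"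
  by (simp add: raag_def group_presented_group)

end

theory Submission
  imports Defs "HOL-Algebra.Multiplicative_Group"
begin

text \<open>
  If the graph is a clique, the group is free abelian of positive rank, and inversion generates a
  normal subgroup of order two of its automorphism group.

  Otherwise there are non-adjacent vertices \<open>v \<noteq> w\<close>, and two properties of \<open>A = raag V E\<close> are enough
  to exclude finite normal subgroups, by \<open>no_finite_normal_subgroup_AutoGroup\<close>. First, roots in \<open>A\<close>
  are unique (\<open>raag_unique_roots\<close>), so \<open>A\<close> and its quotient by the centre are torsion-free.
  Hence an automorphism in a finite normal subgroup has trivial commutators with the inner
  automorphisms, which means that it multiplies each element by a central factor. Secondly, the
  exponent sum of \<open>w\<close> is a homomorphism onto the integers that vanishes on the centre
  (\<open>exponent_center\<close>), as the image of \<open>A\<close> in a Heisenberg group shows. So for central \<open>c\<close> there is a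
  transvection multiplying \<open>w\<close> by \<open>c\<close>, and commutators with these transvections show that the
  given automorphism fixes the centre pointwise. An automorphism that moves each element by a
  central factor and fixes the centre has infinite order unless it is the identity.

  Uniqueness of roots comes from a faithful unipotent action in the manner of Magnus, in which a
  vertex \<open>x\<close> acts as \<open>1 + x\<close> with \<open>x^2 = 0\<close>: unipotent operators over a torsion-free ring have
  unique roots (\<open>foldr_magnus_unique_root\<close>). Faithfulness (\<open>magnus_faithful\<close>) is read off from the
  leading coefficient of an expression with the fewest syllables.
\<close>

section \<open>Finite normal subgroups of automorphism groups\<close>

context group
begin

lemma auto_closed: "f \<in> auto G \<Longrightarrow> x \<in> carrier G \<Longrightarrow> f x \<in> carrier G"
  by (auto simp: auto_def Bij_def bij_betw_def)

lemma auto_group_hom: "f \<in> auto G \<Longrightarrow> group_hom G G f"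
  by (unfold_locales) (auto simp: auto_def)

lemma auto_eqI:
  "f \<in> auto G \<Longrightarrow> g \<in> auto G \<Longrightarrow> (\<And>x. x \<in> carrier G \<Longrightarrow> f x = g x) \<Longrightarrow> f = g"
  by (rule extensionalityI) (auto simp: auto_def Bij_def)

lemma autoI:
  assumes closed: "\<And>x. x \<in> carrier G \<Longrightarrow> f x \<in> carrier G" "\<And>x. x \<in> carrier G \<Longrightarrow> g x \<in> carrier G"
    and inverse: "\<And>x. x \<in> carrier G \<Longrightarrow> f (g x) = x" "\<And>x. x \<in> carrier G \<Longrightarrow> g (f x) = x"
    and "\<And>x y. x \<in> carrier G \<Longrightarrow> y \<in> carrier G \<Longrightarrow> f (x \<otimes> y) = f x \<otimes> f y"
  shows "restrict f (carrier G) \<in> auto G"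
proof -
  have "bij_betw f (carrier G) (carrier G)"
    by (rule bij_betw_byWitness[where f' = g]) (use assms in auto)
  then show ?thesis
    using assms by (auto simp: auto_def hom_def Bij_def bij_betw_restrict_eq)
qed

lemma AutoGroup_carrier: "carrier (AutoGroup G) = auto G"
  by (simp add: AutoGroup_def)

lemma AutoGroup_one: "x \<in> carrier G \<Longrightarrow> \<one>\<^bsub>AutoGroup G\<^esub> x = x"
  by (simp add: AutoGroup_def BijGroup_def)

lemma AutoGroup_mult:
  "f \<in> auto G \<Longrightarrow> g \<in> auto G \<Longrightarrow> x \<in> carrier G \<Longrightarrow> (f \<otimes>\<^bsub>AutoGroup G\<^esub> g) x = f (g x)"
  by (simp add: AutoGroup_def BijGroup_def auto_def compose_def)

lemma AutoGroup_pow_Suc_apply: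
  assumes "f \<in> auto G" "x \<in> carrier G"
  shows "(f [^]\<^bsub>AutoGroup G\<^esub> Suc n) x = (f [^]\<^bsub>AutoGroup G\<^esub> n) (f x)"
  using assms monoid.nat_pow_closed[OF group.is_monoid[OF AutoGroup], of f n]
  by (simp add: AutoGroup_mult AutoGroup_carrier)

end

lemma (in group) finite_subgroup_torsion:
  assumes "subgroup N G" "finite N" "x \<in> N"
  shows "\<exists>m > 0. x [^] (m :: nat) = \<one>"
proof -
  interpret N: group "G\<lparr>carrier := N\<rparr>" using assms(1) by (rule subgroup_imp_group)
  have "x [^] card N = \<one>"
    using N.pow_order_eq_1[of x] assms by (simp add: order_def flip: nat_pow_consistent)
  then show ?thesis using assms by (intro exI[of _ "card N"]) (auto simp: card_gt_0_iff)
qed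

lemma (in group) int_pow_commute:
  assumes "a \<in> carrier G" "b \<in> carrier G" "a \<otimes> b = b \<otimes> a"
  shows "a [^] (i :: int) \<otimes> b = b \<otimes> a [^] i"
proof -
  have "b = inv a \<otimes> (b \<otimes> a)"
    using assms(1,2) by (simp add: m_assoc[symmetric] flip: assms(3))
  then have "b \<otimes> inv a = inv a \<otimes> (b \<otimes> a) \<otimes> inv a"
    by simp
  then have "inv a \<otimes> b = b \<otimes> inv a"
    using assms(1,2) by (simp add: m_assoc)
  then have "inv a [^] n \<otimes> b = b \<otimes> inv a [^] n" for n :: nat
    using assms(1,2) by (intro group_commutes_pow) auto
  then have "inv (a [^] n) \<otimes> b = b \<otimes> inv (a [^] n)" for n :: nat
    using assms(1) by (simp add: nat_pow_inv)
  then show ?thesis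
    unfolding int_pow_def2 using group_commutes_pow[OF assms(3,1,2)] by presburger
qed

lemma (in group) inv_cancel:
  assumes "x \<in> carrier G" "y \<in> carrier G"
  shows "x \<otimes> (inv x \<otimes> y) = y" "inv x \<otimes> (x \<otimes> y) = y"
  using assms by (simp_all flip: m_assoc)

definition center :: "('a, 'b) monoid_scheme \<Rightarrow> 'a set" where
  "center G = {c \<in> carrier G. \<forall>x \<in> carrier G. c \<otimes>\<^bsub>G\<^esub> x = x \<otimes>\<^bsub>G\<^esub> c}"

context group
begin

lemma center_closed: "c \<in> center G \<Longrightarrow> c \<in> carrier G"
  by (simp add: center_def)

lemma center_comm: "c \<in> center G \<Longrightarrow> x \<in> carrier G \<Longrightarrow> c \<otimes> x = x \<otimes> c"
  by (simp add: center_def)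

lemma center_int_pow: "c \<in> center G \<Longrightarrow> c [^] (i :: int) \<in> center G"
  by (auto simp: center_def int_pow_commute)

definition conjugation :: "'a \<Rightarrow> 'a \<Rightarrow> 'a" where
  "conjugation h = (\<lambda>x \<in> carrier G. h \<otimes> x \<otimes> inv h)"

text \<open>
  If \<open>\<epsilon>\<close> is a homomorphism to the integers that vanishes on the centre, then
  multiplying by the \<open>\<epsilon> x\<close>-th power of a central element is an automorphism. On a
  right-angled Artin group with \<open>\<epsilon>\<close> the exponent sum of a vertex \<open>w\<close>, it sends \<open>w\<close> to
  \<open>w \<otimes> c\<close> and fixes the other vertices.
\<close>

definition transvection :: "('a \<Rightarrow> int) \<Rightarrow> 'a \<Rightarrow> 'a \<Rightarrow> 'a" where
  "transvection \<epsilon> c = (\<lambda>x \<in> carrier G. x \<otimes> c [^] \<epsilon> x)"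

lemma conjugation_auto:
  assumes h: "h \<in> carrier G"
  shows "conjugation h \<in> auto G"
  unfolding conjugation_def
  by (rule autoI[of _ "\<lambda>x. inv h \<otimes> x \<otimes> h"]) (use h in \<open>auto simp: m_assoc inv_cancel\<close>)

text \<open>
  Multiplying on the right by \<open>h [^] n\<close> instead of its inverse keeps the induction free of
  inverses.
\<close>

lemma conjugation_pow:
  assumes h: "h \<in> carrier G" and x: "x \<in> carrier G"
  shows "(conjugation h [^]\<^bsub>AutoGroup G\<^esub> (n :: nat)) x \<otimes> h [^] n = h [^] n \<otimes> x"
  using x
proof (induction n arbitrary: x)
  case (Suc n)
  let ?P = "(conjugation h [^]\<^bsub>AutoGroup G\<^esub> n) (conjugation h x)"
  have hx: "conjugation h x \<in> carrier G" by (rule auto_closed[OF conjugation_auto[OF h] Suc.prems])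
  have P: "?P \<in> carrier G"
    using auto_closed[OF _ hx] monoid.nat_pow_closed[OF group.is_monoid[OF AutoGroup]] conjugation_auto[OF h]
    by (simp add: AutoGroup_carrier)
  have "?P \<otimes> h [^] Suc n = ?P \<otimes> h [^] n \<otimes> h"
    using P h by (simp add: m_assoc)
  also have "\<dots> = h [^] n \<otimes> (conjugation h x \<otimes> h)"
    using Suc.IH[OF hx] h hx by (simp add: m_assoc)
  also have "conjugation h x \<otimes> h = h \<otimes> x"
    using Suc.prems h by (simp add: conjugation_def m_assoc)
  also have "h [^] n \<otimes> (h \<otimes> x) = h [^] Suc n \<otimes> x"
    using Suc.prems h by (simp add: m_assoc)
  finally show ?case
    using AutoGroup_pow_Suc_apply[OF conjugation_auto[OF h] Suc.prems] by (simp only:)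
qed (simp add: AutoGroup_one)

text \<open>
  Let \<open>n\<close> lie in a finite normal subgroup \<open>N\<close>. For every automorphism \<open>\<alpha>\<close>, the commutator of
  \<open>n\<close> and \<open>\<alpha>\<close> lies in \<open>N\<close>, so it has finite order.

  With \<open>\<alpha>\<close> conjugation by \<open>g\<close>, the commutator is conjugation by \<open>z = n g \<otimes> inv g\<close>. Some
  positive power of \<open>z\<close> is then central, so \<open>z\<close> and its conjugates have a common power, and
  unique roots make \<open>z\<close> central. Thus \<open>n\<close> moves each element by a central factor, and in
  particular it preserves \<open>\<epsilon>\<close>.

  With \<open>\<alpha>\<close> the transvection by a central \<open>c\<close>, the commutator is the transvection by
  \<open>n c \<otimes> inv c\<close>, because \<open>n\<close> preserves \<open>\<epsilon>\<close>. Its \<open>m\<close>-th power multiplies \<open>w\<close> by the \<open>m\<close>-th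
  power of \<open>n c \<otimes> inv c\<close>, so torsion-freeness gives \<open>n c = c\<close>.

  Now \<open>n\<close> fixes the factors \<open>n g \<otimes> inv g\<close>, so the \<open>m\<close>-th power of \<open>n\<close> multiplies \<open>g\<close> by the
  \<open>m\<close>-th power of its factor. Torsion-freeness, used once more, gives \<open>n g = g\<close>.
\<close>

lemma no_finite_normal_subgroup_AutoGroup:
  assumes unique_roots: "\<And>a b m. a \<in> carrier G \<Longrightarrow> b \<in> carrier G \<Longrightarrow> (m :: nat) > 0 \<Longrightarrow>
      a [^] m = b [^] m \<Longrightarrow> a = b"
    and \<epsilon>_mult: "\<And>x y. x \<in> carrier G \<Longrightarrow> y \<in> carrier G \<Longrightarrow> \<epsilon> (x \<otimes> y) = \<epsilon> x + (\<epsilon> y :: int)"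
    and \<epsilon>_center: "\<And>c. c \<in> center G \<Longrightarrow> \<epsilon> c = 0"
    and w: "w \<in> carrier G" "\<epsilon> w = 1"
    and N: "N \<lhd> AutoGroup G" "finite N"
  shows "N = {\<one>\<^bsub>AutoGroup G\<^esub>}"
proof -
  let ?A = "AutoGroup G"
  interpret A: group ?A by (rule AutoGroup)
  interpret N: normal N ?A by (rule N(1))
  have Na: "n \<in> auto G" if "n \<in> N" for n
    using N.subset that by (auto simp: AutoGroup_carrier)
  have torsion: "\<exists>m > 0. n [^]\<^bsub>?A\<^esub> (m :: nat) = \<one>\<^bsub>?A\<^esub>" if "n \<in> N" for n
    using A.finite_subgroup_torsion[OF N.subgroup_axioms N(2) that] .
  have torsion_free: "c = \<one>" if "c \<in> carrier G" "m > 0" "c [^] (m :: nat) = \<one>" for c m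
    using unique_roots[of c \<one> m] that by simp
  \<comment> \<open>The equation says that \<open>\<beta>\<close> is the commutator of \<open>n\<close> and \<open>\<alpha>\<close>, with no inverses to evaluate.\<close>
  have commutator: "\<beta> \<in> N"
    if n: "n \<in> N" and \<alpha>: "\<alpha> \<in> auto G" and \<beta>: "\<beta> \<in> auto G"
      and eq: "\<And>x. x \<in> carrier G \<Longrightarrow> \<beta> (\<alpha> (n x)) = n (\<alpha> x)" for n \<alpha> \<beta>
  proof -
    have "\<beta> \<otimes>\<^bsub>?A\<^esub> \<alpha> \<otimes>\<^bsub>?A\<^esub> n = n \<otimes>\<^bsub>?A\<^esub> \<alpha>"
      using n \<alpha> \<beta> Na[OF n] eq A.m_closed[unfolded AutoGroup_carrier]
      by (intro auto_eqI) (simp_all add: AutoGroup_mult auto_closed)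
    moreover have "\<alpha> \<in> carrier ?A" "\<beta> \<in> carrier ?A" "n \<in> carrier ?A"
      using \<alpha> \<beta> Na[OF n] by (auto simp: AutoGroup_carrier)
    ultimately have "\<beta> = n \<otimes>\<^bsub>?A\<^esub> \<alpha> \<otimes>\<^bsub>?A\<^esub> inv\<^bsub>?A\<^esub> n \<otimes>\<^bsub>?A\<^esub> inv\<^bsub>?A\<^esub> \<alpha>"
      by (simp add: A.inv_solve_right A.inv_solve_right')
    then have "\<beta> = n \<otimes>\<^bsub>?A\<^esub> (\<alpha> \<otimes>\<^bsub>?A\<^esub> inv\<^bsub>?A\<^esub> n \<otimes>\<^bsub>?A\<^esub> inv\<^bsub>?A\<^esub> \<alpha>)"
      using \<open>\<alpha> \<in> carrier ?A\<close> \<open>n \<in> carrier ?A\<close> by (simp add: A.m_assoc)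
    also have "\<dots> \<in> N"
      using n \<alpha> by (intro N.m_closed N.inv_op_closed2 N.m_inv_closed) (auto simp: AutoGroup_carrier)
    finally show ?thesis .
  qed
  define z where "z n g = n g \<otimes> inv g" for n g
  have z_closed: "z n g \<in> carrier G" if "n \<in> N" "g \<in> carrier G" for n g
    using that Na[of n] by (simp add: z_def auto_closed)
  have n_eq: "n g = z n g \<otimes> g" if "n \<in> N" "g \<in> carrier G" for n g
    using that Na[of n] by (simp add: z_def auto_closed m_assoc)
  have z_center: "z n g \<in> center G" if n: "n \<in> N" and g: "g \<in> carrier G" for n g
  proof -
    let ?h = "z n g"
    have h: "?h \<in> carrier G" using n g by (rule z_closed)
    have "conjugation ?h \<in> N"
    proof (rule commutator[OF n conjugation_auto[OF g] conjugation_auto[OF h]])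
      fix x assume x: "x \<in> carrier G"
      interpret n: group_hom G G n using Na[OF n] by (rule auto_group_hom)
      show "conjugation ?h (conjugation g (n x)) = n (conjugation g x)"
        using x g h by (simp add: conjugation_def z_def m_assoc inv_mult_group inv_cancel)
    qed
    then obtain m :: nat where m: "m > 0" "conjugation ?h [^]\<^bsub>?A\<^esub> m = \<one>\<^bsub>?A\<^esub>"
      using torsion by blast
    have "?h \<otimes> x = x \<otimes> ?h" if x: "x \<in> carrier G" for x
    proof -
      have "x \<otimes> ?h [^] m = ?h [^] m \<otimes> x"
        using conjugation_pow[OF h x, of m] m x by (simp add: AutoGroup_one)
      then have pow: "x \<otimes> ?h [^] m \<otimes> inv x = ?h [^] m"
        using x h by (simp add: m_assoc)
      have "(x \<otimes> ?h \<otimes> inv x) [^] k = x \<otimes> ?h [^] k \<otimes> inv x" for k :: nat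
        using x h by (induction k) (auto simp: m_assoc inv_cancel)
      then have "(x \<otimes> ?h \<otimes> inv x) [^] m = ?h [^] m"
        using pow by simp
      then have "x \<otimes> ?h \<otimes> inv x = ?h"
        by (rule unique_roots[OF _ _ m(1), rotated 2]) (use x h in auto)
      then show ?thesis using inv_solve_right'[of ?h "x \<otimes> ?h" x] x h by simp
    qed
    then show ?thesis using h by (simp add: center_def)
  qed
  have \<epsilon>_n: "\<epsilon> (n g) = \<epsilon> g" if "n \<in> N" "g \<in> carrier G" for n g
    using n_eq[OF that] z_center[OF that] that by (simp add: \<epsilon>_mult \<epsilon>_center center_closed)
  have trans_auto: "transvection \<epsilon> c \<in> auto G" if c: "c \<in> center G" for c
    unfolding transvection_def
  proof (rule autoI[of _ "\<lambda>x. x \<otimes> c [^] - \<epsilon> x"])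
    have ci: "c [^] i \<in> carrier G" "\<epsilon> (c [^] i) = 0" for i :: int
      using center_int_pow[OF c] by (auto simp: center_closed \<epsilon>_center)
    fix x y assume x: "x \<in> carrier G" and y: "y \<in> carrier G"
    show "x \<otimes> y \<otimes> c [^] \<epsilon> (x \<otimes> y) = x \<otimes> c [^] \<epsilon> x \<otimes> (y \<otimes> c [^] \<epsilon> y)"
    proof -
      have "c [^] \<epsilon> x \<otimes> y = y \<otimes> c [^] \<epsilon> x" using center_comm[OF center_int_pow[OF c] y] .
      then have "x \<otimes> c [^] \<epsilon> x \<otimes> (y \<otimes> c [^] \<epsilon> y) = x \<otimes> (y \<otimes> c [^] \<epsilon> x) \<otimes> c [^] \<epsilon> y"
        using x y ci by (metis m_assoc m_closed)
      also have "\<dots> = x \<otimes> y \<otimes> (c [^] \<epsilon> x \<otimes> c [^] \<epsilon> y)"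
        using x y ci by (simp add: m_assoc)
      finally show ?thesis
        using x y c by (simp add: \<epsilon>_mult int_pow_mult center_closed)
    qed
  next
    have ci: "c [^] i \<in> carrier G" "\<epsilon> (c [^] i) = 0" for i :: int
      using center_int_pow[OF c] by (auto simp: center_closed \<epsilon>_center)
    fix x assume x: "x \<in> carrier G"
    show "x \<otimes> c [^] - \<epsilon> x \<otimes> c [^] \<epsilon> (x \<otimes> c [^] - \<epsilon> x) = x"
      "x \<otimes> c [^] \<epsilon> x \<otimes> c [^] - \<epsilon> (x \<otimes> c [^] \<epsilon> x) = x"
      using x ci c by (simp_all add: \<epsilon>_mult m_assoc center_closed flip: int_pow_mult)
  qed (use c in \<open>auto simp: center_closed\<close>)
  have fixes_center: "n c = c" if n: "n \<in> N" and c: "c \<in> center G" for n c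
  proof -
    let ?d = "z n c"
    have cc: "c \<in> carrier G" using c by (rule center_closed)
    have d: "?d \<in> center G" "?d \<in> carrier G" using z_center[OF n cc] by (auto simp: center_closed)
    interpret n: group_hom G G n using Na[OF n] by (rule auto_group_hom)
    have "transvection \<epsilon> ?d \<in> N"
    proof (rule commutator[OF n trans_auto[OF c] trans_auto[OF d(1)]])
      fix x assume x: "x \<in> carrier G"
      let ?e = "\<epsilon> x"
      have ce: "c [^] ?e \<in> carrier G" "\<epsilon> (c [^] ?e) = 0"
        using center_int_pow[OF c, of ?e] by (auto simp: center_closed \<epsilon>_center)
      have "transvection \<epsilon> ?d (transvection \<epsilon> c (n x)) = n x \<otimes> (c [^] ?e \<otimes> ?d [^] ?e)"
        using x n ce cc d by (simp add: transvection_def \<epsilon>_n \<epsilon>_mult m_assoc)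
      also have "c [^] ?e \<otimes> ?d [^] ?e = (n c) [^] ?e"
        using n_eq[OF n cc] cc d center_comm[OF d(1) cc] by (simp add: int_pow_mult_distrib)
      also have "n x \<otimes> (n c) [^] ?e = n (transvection \<epsilon> c x)"
        using x cc by (simp add: transvection_def n.hom_int_pow)
      finally show "transvection \<epsilon> ?d (transvection \<epsilon> c (n x)) = n (transvection \<epsilon> c x)" .
    qed
    then obtain m :: nat where m: "m > 0" "transvection \<epsilon> ?d [^]\<^bsub>?A\<^esub> m = \<one>\<^bsub>?A\<^esub>"
      using torsion by blast
    have "(transvection \<epsilon> ?d [^]\<^bsub>?A\<^esub> k) x = x \<otimes> ?d [^] k"
      if "x \<in> carrier G" "\<epsilon> x = 1" for k :: nat and x
      using that
    proof (induction k arbitrary: x)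
      case (Suc k)
      then have "(transvection \<epsilon> ?d [^]\<^bsub>?A\<^esub> Suc k) x = (transvection \<epsilon> ?d [^]\<^bsub>?A\<^esub> k) (x \<otimes> ?d)"
        using d unfolding AutoGroup_pow_Suc_apply[OF trans_auto[OF d(1)] Suc.prems(1)]
        by (simp add: transvection_def)
      also have "\<dots> = x \<otimes> ?d \<otimes> ?d [^] k"
        using Suc d by (intro Suc.IH) (auto simp: \<epsilon>_mult \<epsilon>_center)
      also have "\<dots> = x \<otimes> ?d [^] Suc k"
        using Suc.prems d by (simp only: nat_pow_Suc2 m_assoc nat_pow_closed)
      finally show ?case .
    qed (simp add: AutoGroup_one)
    from this[OF w, of m] have "w \<otimes> ?d [^] m = w"
      unfolding m(2) using w by (simp add: AutoGroup_one)
    then have "?d [^] m = \<one>" using w d by simp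
    then have "?d = \<one>" using torsion_free d m by blast
    then show ?thesis using n_eq[OF n cc] cc by simp
  qed
  have "n = \<one>\<^bsub>?A\<^esub>" if n: "n \<in> N" for n
  proof (rule auto_eqI)
    fix g assume g: "g \<in> carrier G"
    let ?z = "z n g"
    have z: "?z \<in> carrier G" using z_closed[OF n g] .
    obtain m :: nat where m: "m > 0" "n [^]\<^bsub>?A\<^esub> m = \<one>\<^bsub>?A\<^esub>" using torsion[OF n] by blast
    have "(n [^]\<^bsub>?A\<^esub> k) g = ?z [^] k \<otimes> g" for k :: nat
    proof (induction k)
      case (Suc k)
      interpret nk: group_hom G G "n [^]\<^bsub>?A\<^esub> k"
        using A.nat_pow_closed[of n k] Na[OF n] by (intro auto_group_hom) (simp add: AutoGroup_carrier)
      have "(n [^]\<^bsub>?A\<^esub> j) ?z = ?z" for j :: nat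
      proof (induction j)
        case (Suc j)
        then show ?case
          unfolding AutoGroup_pow_Suc_apply[OF Na[OF n] z] fixes_center[OF n z_center[OF n g]] .
      qed (simp add: AutoGroup_one z)
      then have "(n [^]\<^bsub>?A\<^esub> Suc k) g = ?z \<otimes> (?z [^] k \<otimes> g)"
        using Suc g z unfolding AutoGroup_pow_Suc_apply[OF Na[OF n] g]
        by (simp only: n_eq[OF n g] nk.hom_mult)
      also have "\<dots> = ?z [^] Suc k \<otimes> g"
        using g z by (simp only: nat_pow_Suc2 m_assoc nat_pow_closed)
      finally show ?case .
    qed (simp add: AutoGroup_one g)
    from this[of m] have "?z [^] m \<otimes> g = g"
      unfolding m(2) using g by (simp add: AutoGroup_one)
    then have "?z [^] m = \<one>" using g z by (simp add: l_cancel_one)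
    then have "?z = \<one>" using torsion_free z m by blast
    then show "n g = \<one>\<^bsub>?A\<^esub> g" using n_eq[OF n g] g by (simp add: AutoGroup_one)
  qed (use n Na A.one_closed in \<open>auto simp: AutoGroup_carrier\<close>)
  then show ?thesis using N.one_closed by blast
qed

end

text \<open>
  In an abelian group inversion is an automorphism that commutes with every other, so together
  with the identity it forms a normal subgroup.
\<close>

lemma (in comm_group) inversion_normal_AutoGroup:
  assumes x: "x \<in> carrier G" "inv x \<noteq> x"
  shows "\<exists>N. N \<lhd> AutoGroup G \<and> finite N \<and> N \<noteq> {\<one>\<^bsub>AutoGroup G\<^esub>}"
proof -
  let ?A = "AutoGroup G"
  interpret A: group ?A by (rule AutoGroup)
  define \<iota> where "\<iota> = (\<lambda>x \<in> carrier G. inv x)"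
  have \<iota>: "\<iota> \<in> auto G"
    unfolding \<iota>_def by (rule autoI[of _ "m_inv G"]) (auto simp: inv_mult)
  have central: "f \<otimes>\<^bsub>?A\<^esub> \<iota> = \<iota> \<otimes>\<^bsub>?A\<^esub> f" if f: "f \<in> auto G" for f
  proof (rule auto_eqI)
    fix y assume y: "y \<in> carrier G"
    interpret f: group_hom G G f using f by (rule auto_group_hom)
    show "(f \<otimes>\<^bsub>?A\<^esub> \<iota>) y = (\<iota> \<otimes>\<^bsub>?A\<^esub> f) y"
      using f \<iota> y by (simp add: AutoGroup_mult) (simp add: \<iota>_def)
  qed (use f \<iota> A.m_closed in \<open>auto simp: AutoGroup_carrier\<close>)
  have square: "\<iota> \<otimes>\<^bsub>?A\<^esub> \<iota> = \<one>\<^bsub>?A\<^esub>"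
    using \<iota> A.m_closed[of \<iota> \<iota>] A.one_closed
    by (intro auto_eqI) (auto simp: AutoGroup_carrier AutoGroup_mult AutoGroup_one, simp add: \<iota>_def)
  have \<iota>_inv: "inv\<^bsub>?A\<^esub> \<iota> = \<iota>"
    using \<iota> square by (intro A.inv_equality) (auto simp: AutoGroup_carrier)
  have "\<iota> x \<noteq> \<one>\<^bsub>?A\<^esub> x" using x by (simp add: \<iota>_def AutoGroup_one)
  then have "\<iota> \<noteq> \<one>\<^bsub>?A\<^esub>" by auto
  moreover have "{\<one>\<^bsub>?A\<^esub>, \<iota>} \<lhd> ?A"
    unfolding A.normal_inv_iff
  proof (intro conjI ballI)
    show "subgroup {\<one>\<^bsub>?A\<^esub>, \<iota>} ?A"
      using \<iota>[folded AutoGroup_carrier] by unfold_locales (auto simp: square \<iota>_inv)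
    fix f h assume f: "f \<in> carrier ?A" and h: "h \<in> {\<one>\<^bsub>?A\<^esub>, \<iota>}"
    have "f \<otimes>\<^bsub>?A\<^esub> h = h \<otimes>\<^bsub>?A\<^esub> f" "h \<in> carrier ?A"
      using central[of f] f h \<iota> by (auto simp flip: AutoGroup_carrier)
    then show "f \<otimes>\<^bsub>?A\<^esub> h \<otimes>\<^bsub>?A\<^esub> inv\<^bsub>?A\<^esub> f \<in> {\<one>\<^bsub>?A\<^esub>, \<iota>}"
      using f h by (simp add: A.m_assoc)
  qed
  ultimately show ?thesis by (intro exI[of _ "{\<one>\<^bsub>?A\<^esub>, \<iota>}"]) auto
qed


section \<open>Words in right-angled Artin groups\<close>

text \<open>
  An action of the letters that respects the defining relations is an action of the presented group.
  Restricting it to an invariant set \<open>S\<close> matters when inverse letters cancel only there.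
\<close>

lemma foldr_pres_rel:
  fixes act :: "'a \<times> bool \<Rightarrow> 's \<Rightarrow> 's"
  assumes uv: "(u, v) \<in> pres_rel X R"
    and stable: "\<And>a s. s \<in> S \<Longrightarrow> act a s \<in> S"
    and inverse: "\<And>x b s. s \<in> S \<Longrightarrow> act (x, b) (act (x, \<not> b) s) = s"
    and relators: "\<And>l r s. (l, r) \<in> R \<Longrightarrow> s \<in> S \<Longrightarrow> foldr act l s = foldr act r s"
    and "s \<in> S"
  shows "foldr act u s = foldr act v s"
proof -
  have S: "foldr act w s \<in> S" if "s \<in> S" for w s
    using that by (induction w) (auto intro: stable)
  show ?thesis
    using uv \<open>s \<in> S\<close>
    by (induction arbitrary: s rule: pres_rel.induct) (simp_all add: S inverse relators)
qed

abbreviation raag_rel :: "'a set \<Rightarrow> 'a set set \<Rightarrow> ('a word \<times> 'a word) set" where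
  "raag_rel V E \<equiv> pres_rel V
     {([(v, True), (w, True)], [(w, True), (v, True)]) | v w. {v, w} \<in> E}"

abbreviation sg :: "bool \<Rightarrow> int" where
  "sg b \<equiv> (if b then 1 else - 1)"

definition gen :: "'a set \<Rightarrow> 'a set set \<Rightarrow> 'a \<Rightarrow> 'a word set" where
  "gen V E x = raag_rel V E `` {[(x, True)]}"

lemma raag_mult: "u \<in> words V \<Longrightarrow> v \<in> words V \<Longrightarrow>
    raag_rel V E `` {u} \<otimes>\<^bsub>raag V E\<^esub> raag_rel V E `` {v} = raag_rel V E `` {u @ v}"
  unfolding raag_def by (rule presented_group_mult)

lemma raag_carrier: "A \<in> carrier (raag V E) \<longleftrightarrow> (\<exists>u \<in> words V. A = raag_rel V E `` {u})"
  unfolding raag_def by (rule presented_group_carrier)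

lemma raag_one: "\<one>\<^bsub>raag V E\<^esub> = raag_rel V E `` {[]}"
  by (simp add: raag_def presented_group_def)

lemma raag_class_eq_iff:
  assumes "u \<in> words V" "v \<in> words V"
  shows "raag_rel V E `` {u} = raag_rel V E `` {v} \<longleftrightarrow> (u, v) \<in> raag_rel V E"
  using eq_equiv_class_iff[OF equiv_pres_rel] assms by blast

lemma gen_closed: "x \<in> V \<Longrightarrow> gen V E x \<in> carrier (raag V E)"
  by (auto simp: gen_def raag_carrier simp del: Image_singleton_iff intro!: bexI[of _ "[(x, True)]"])

lemma gen_commute:
  assumes "x \<in> V" "y \<in> V" "{x, y} \<in> E"
  shows "gen V E x \<otimes>\<^bsub>raag V E\<^esub> gen V E y = gen V E y \<otimes>\<^bsub>raag V E\<^esub> gen V E x"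
proof -
  have "([] @ [(x, True), (y, True)] @ [], [] @ [(y, True), (x, True)] @ []) \<in> raag_rel V E"
    using assms by (intro pres_rel.relation) auto
  then show ?thesis
    using assms unfolding gen_def by (subst (1 2) raag_mult) (auto intro!: pres_rel_class_eq simp del: Image_singleton_iff)
qed

lemma gen_inv:
  assumes "x \<in> V"
  shows "raag_rel V E `` {[(x, False)]} = inv\<^bsub>raag V E\<^esub> gen V E x"
proof -
  interpret group "raag V E" by (rule group_raag)
  have "([] @ [(x, False), (x, \<not> False)] @ [], [] @ []) \<in> raag_rel V E"
    using assms by (intro pres_rel.cancel) auto
  then have "raag_rel V E `` {[(x, False)]} \<otimes>\<^bsub>raag V E\<^esub> gen V E x = \<one>\<^bsub>raag V E\<^esub>"
    using assms unfolding gen_def raag_one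
    by (subst raag_mult) (auto intro!: pres_rel_class_eq simp del: Image_singleton_iff)
  then show ?thesis
    using assms by (intro inv_equality[symmetric] gen_closed)
      (auto simp: raag_carrier simp del: Image_singleton_iff intro!: bexI[of _ "[(x, False)]"])
qed


section \<open>Unique roots from a unipotent action\<close>

text \<open>
  These functions form the linear dual of the ring generated by the vertices, in which adjacent
  vertices commute and every vertex has square zero: a list stands for the monomial of its
  entries. In the completion of that ring \<open>1 + x\<close> has the inverse \<open>1 - x\<close>, and sending \<open>x\<close> to
  \<open>1 + x\<close> is a variant of the Magnus embedding. Working with the dual avoids both the quotient
  and the completion.
\<close>

definition square_free_funs :: "'a set set \<Rightarrow> ('a list \<Rightarrow> int) set" where
  "square_free_funs E = {f. (\<forall>p q v w. {v, w} \<in> E \<longrightarrow> f (p @ [v, w] @ q) = f (p @ [w, v] @ q)) \<and>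
     (\<forall>p q v. f (p @ [v, v] @ q) = 0)}"

text \<open>
  The action of \<open>1 + x\<close> or \<open>1 - x\<close> on the dual by translation.
\<close>

definition magnus :: "'a \<times> bool \<Rightarrow> ('a list \<Rightarrow> int) \<Rightarrow> 'a list \<Rightarrow> int" where
  "magnus a f = (\<lambda>t. f t + sg (snd a) * f (t @ [fst a]))"

lemma square_free_funs_swap:
  "f \<in> square_free_funs E \<Longrightarrow> {v, w} \<in> E \<Longrightarrow> f (p @ v # w # q) = f (p @ w # v # q)"
  and square_free_funs_square: "f \<in> square_free_funs E \<Longrightarrow> f (p @ v # v # q) = 0"
  by (auto simp: square_free_funs_def)

lemma square_free_funsI:
  assumes "\<And>p q v w. {v, w} \<in> E \<Longrightarrow> f (p @ v # w # q) = f (p @ w # v # q)"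
    and "\<And>p q v. f (p @ v # v # q) = 0"
  shows "f \<in> square_free_funs E"
  unfolding square_free_funs_def append.simps using assms by blast

lemma square_free_funs_lincomb:
  assumes "f \<in> square_free_funs E" "g \<in> square_free_funs E"
  shows "(\<lambda>t. f t + c * g t) \<in> square_free_funs E"
proof (rule square_free_funsI)
  fix p q v w assume "{v, w} \<in> E"
  then show "f (p @ v # w # q) + c * g (p @ v # w # q) = f (p @ w # v # q) + c * g (p @ w # v # q)"
    by (simp only: square_free_funs_swap[OF assms(1), of v w] square_free_funs_swap[OF assms(2), of v w])
qed (simp add: square_free_funs_square[OF assms(1)] square_free_funs_square[OF assms(2)])

lemma square_free_funs_snoc:
  assumes "f \<in> square_free_funs E"
  shows "(\<lambda>t. f (t @ [x])) \<in> square_free_funs E"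
proof (rule square_free_funsI)
  fix p q v w assume "{v, w} \<in> E"
  then show "f ((p @ v # w # q) @ [x]) = f ((p @ w # v # q) @ [x])"
    by (simp only: append_assoc append.simps square_free_funs_swap[OF assms, of v w])
qed (simp add: square_free_funs_square[OF assms])

lemma magnus_stable: "f \<in> square_free_funs E \<Longrightarrow> magnus a f \<in> square_free_funs E"
  unfolding magnus_def by (intro square_free_funs_lincomb square_free_funs_snoc)

lemma foldr_magnus_stable:
  "f \<in> square_free_funs E \<Longrightarrow> foldr magnus u f \<in> square_free_funs E"
  by (induction u) (auto intro: magnus_stable)

lemma foldr_magnus_raag_rel:
  assumes "(u, v) \<in> raag_rel V E" "f \<in> square_free_funs E"
  shows "foldr magnus u f = foldr magnus v f"
proof (rule foldr_pres_rel[OF assms(1) _ _ _ assms(2)])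
  fix x b and f :: "'a list \<Rightarrow> int" assume "f \<in> square_free_funs E"
  then show "magnus (x, b) (magnus (x, \<not> b) f) = f"
    using square_free_funs_square[of f E _ x "[]"] by (auto simp: magnus_def)
next
  fix l r :: "'a word" and f :: "'a list \<Rightarrow> int"
  assume f: "f \<in> square_free_funs E"
    and "(l, r) \<in> {([(v, True), (w, True)], [(w, True), (v, True)]) | v w. {v, w} \<in> E}"
  then obtain v w where "l = [(v, True), (w, True)]" "r = [(w, True), (v, True)]" "{v, w} \<in> E"
    by blast
  then show "foldr magnus l f = foldr magnus r f"
    using square_free_funs_swap[OF f, of v w _ "[]"] by (auto simp: magnus_def)
qed (rule magnus_stable)

lemma foldr_magnus_diff:
  "foldr magnus u (\<lambda>t. f t - g t) = (\<lambda>t. foldr magnus u f t - foldr magnus u g t)"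
  by (induction u) (auto simp: magnus_def)

text \<open>
  The action is unipotent: a letter changes the value at \<open>t\<close> only by a value at a longer list.
\<close>

lemma foldr_magnus_top:
  assumes "\<And>t. length t > d \<Longrightarrow> f t = 0" and "length t \<ge> d"
  shows "foldr magnus u f t = f t"
  using assms(2)
proof (induction u arbitrary: t)
  case (Cons a u)
  then show ?case by (simp add: magnus_def assms(1))
qed simp

text \<open>
  For unipotent operators \<open>U\<close> and \<open>W\<close> with equal \<open>m\<close>-th powers, suppose \<open>U\<close> and \<open>W\<close> agree on
  functions supported in lengths below \<open>d\<close>, let \<open>f\<close> be supported in lengths up to \<open>d\<close>, and put
  \<open>g = U f - W f\<close>. Then \<open>h j = U^j f - W^j f\<close> satisfies \<open>h (j + 1) = U (h j) + g\<close>, since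
  \<open>U - W\<close> does not see the difference of \<open>W^j f\<close> and \<open>f\<close>. In the top degree of \<open>g\<close> the operator
  \<open>U\<close> is the identity, so there \<open>h m\<close> is \<open>m g\<close>. But \<open>h m = 0\<close>, hence \<open>g = 0\<close>.
\<close>

lemma foldr_magnus_unique_root:
  fixes f :: "'a list \<Rightarrow> int"
  assumes m: "m > 0"
    and eq: "\<And>f. f \<in> square_free_funs E \<Longrightarrow> (foldr magnus u ^^ m) f = (foldr magnus v ^^ m) f"
    and "f \<in> square_free_funs E" and "\<And>t. length t \<ge> d \<Longrightarrow> f t = 0"
  shows "foldr magnus u f = foldr magnus v f"
  using assms(3,4)
proof (induction d arbitrary: f)
  case 0
  then have "foldr magnus w f t = 0" for w t
    using foldr_magnus_top[of 0 f t w] by simp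
  then show ?case by auto
next
  case (Suc d)
  define U where "U = foldr (magnus :: 'a \<times> bool \<Rightarrow> _) u"
  define W where "W = foldr (magnus :: 'a \<times> bool \<Rightarrow> _) v"
  define g where "g = (\<lambda>t. U f t - W f t)"
  define h where "h = (\<lambda>j t. (U ^^ j) f t - (W ^^ j) f t)"
  have Wj: "(W ^^ j) f \<in> square_free_funs E" "length t \<ge> d \<Longrightarrow> (W ^^ j) f t = f t" for j t
  proof (induction j arbitrary: t)
    case (Suc j)
    {
      case 1 show ?case using Suc.IH(1) by (simp add: W_def foldr_magnus_stable)
    next
      case 2
      have "(W ^^ j) f t = 0" if "length t > d" for t
        using Suc.IH(2)[of t] Suc.prems that \<open>\<And>t. length t \<ge> Suc d \<Longrightarrow> f t = 0\<close> by auto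
      then show ?case
        using foldr_magnus_top[of d "(W ^^ j) f" t v] Suc.IH(2)[of t] 2 by (simp add: W_def)
    }
  qed (use Suc.prems in auto)
  have UW: "U ((W ^^ j) f) t - W ((W ^^ j) f) t = g t" for j t
  proof -
    define k where "k = (\<lambda>t. (W ^^ j) f t - f t)"
    have "k \<in> square_free_funs E"
      using square_free_funs_lincomb[OF Wj(1)[of j] Suc.prems(1), of "- 1"] by (simp add: k_def)
    then have "U k = W k"
      unfolding U_def W_def by (intro Suc.IH) (use Wj(2) in \<open>auto simp: k_def\<close>)
    then have "U k t = W k t" by simp
    then show ?thesis
      by (simp add: k_def U_def W_def foldr_magnus_diff g_def)
  qed
  have h_Suc: "h (Suc j) t = U (h j) t + g t" for j t
    using UW[of j t] by (simp add: h_def U_def foldr_magnus_diff)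
  \<comment> \<open>Downward induction on the length: the top degree of \<open>g\<close> can always be lowered.\<close>
  have g0: "g t = 0" if "length t \<ge> e" for e t
    using that
  proof (induction "Suc d - e" arbitrary: e t)
    case 0
    then have "f t' = 0" if "length t' > length t" for t' using Suc.prems that by simp
    moreover have "f t = 0" using 0 Suc.prems by simp
    ultimately show ?case
      using foldr_magnus_top[of "length t" f t] by (simp add: g_def U_def W_def)
  next
    case (Suc n)
    then have above: "g t = 0" if "length t > e" for t using that Suc.hyps(1)[of "Suc e" t] by auto
    have h_above: "h j t = (if length t = e then int j * g t else 0)" if "length t \<ge> e" for j t
      using that
    proof (induction j arbitrary: t)
      case (Suc j)
      then have "U (h j) t = h j t"
        unfolding U_def by (intro foldr_magnus_top[of e]) auto
      then show ?case using Suc above[of t] by (auto simp: h_Suc algebra_simps)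
    qed (simp add: h_def)
    have "h m t = 0" using eq[OF \<open>f \<in> square_free_funs E\<close>] by (simp add: h_def U_def W_def)
    then show ?case using h_above[of t m] above[of t] m Suc.prems by (auto split: if_splits)
  qed
  show ?case
    using g0[of 0] by (auto simp: g_def U_def W_def)
qed

section \<open>Syllables and faithfulness of the action\<close>

text \<open>
  The syllable \<open>x^e\<close> as a reduced word. A power of a single vertex has to be treated as one unit,
  because the action sends \<open>x^e\<close> to \<open>1 + e x\<close>.
\<close>

definition syll :: "'a \<Rightarrow> int \<Rightarrow> 'a word" where
  "syll x e = replicate (nat \<bar>e\<bar>) (x, e \<ge> 0)"

definition syll_word :: "('a \<times> int) list \<Rightarrow> 'a word" where
  "syll_word s = concat (map (\<lambda>(x, e). syll x e) s)"

lemma syll_word_simps [simp]: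
  "syll_word [] = []" "syll_word (a # s) = syll (fst a) (snd a) @ syll_word s"
  "syll_word (s @ s') = syll_word s @ syll_word s'"
  by (auto simp: syll_word_def split: prod.splits)

lemma syll_in_words [simp]: "x \<in> X \<Longrightarrow> syll x e \<in> words X"
  by (auto simp: syll_def words_def)

lemma syll_word_in_words [simp]: "fst ` set s \<subseteq> X \<Longrightarrow> syll_word s \<in> words X"
  by (induction s) auto

lemma class_syll:
  assumes "x \<in> V"
  shows "raag_rel V E `` {syll x e} = gen V E x [^]\<^bsub>raag V E\<^esub> e"
proof -
  interpret group "raag V E" by (rule group_raag)
  have pow: "raag_rel V E `` {replicate n (x, b)} = raag_rel V E `` {[(x, b)]} [^]\<^bsub>raag V E\<^esub> n" for n b
  proof (induction n)
    case (Suc n)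
    have "raag_rel V E `` {replicate (Suc n) (x, b)}
        = raag_rel V E `` {replicate n (x, b)} \<otimes>\<^bsub>raag V E\<^esub> raag_rel V E `` {[(x, b)]}"
      using assms by (subst raag_mult) (auto simp: words_def replicate_append_same simp del: Image_singleton_iff)
    then show ?case using Suc by (simp del: Image_singleton_iff)
  qed (simp add: raag_one)
  show ?thesis
  proof (cases "e < 0")
    case True
    then have "raag_rel V E `` {syll x e} = (inv\<^bsub>raag V E\<^esub> gen V E x) [^]\<^bsub>raag V E\<^esub> nat (- e)"
      using assms by (simp add: syll_def pow gen_inv del: Image_singleton_iff int_nat_eq)
    then show ?thesis
      using True assms by (simp only: int_pow_def2 if_True nat_pow_inv gen_closed)
  next
    case False
    then have "raag_rel V E `` {syll x e} = gen V E x [^]\<^bsub>raag V E\<^esub> nat e"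
      by (simp only: syll_def pow gen_def) simp
    then show ?thesis
      using False by (simp only: int_pow_def2 if_False)
  qed
qed

lemma syll_merge:
  assumes "x \<in> V"
  shows "(syll x e @ syll x e', syll x (e + e')) \<in> raag_rel V E"
proof -
  interpret group "raag V E" by (rule group_raag)
  show ?thesis
    using assms gen_closed[of x V E]
    by (subst raag_class_eq_iff[symmetric])
      (auto simp: class_syll int_pow_mult simp flip: raag_mult simp del: Image_singleton_iff)
qed

lemma syll_commute:
  assumes "x \<in> V" "y \<in> V" "{x, y} \<in> E"
  shows "(syll x e @ syll y e', syll y e' @ syll x e) \<in> raag_rel V E"
proof -
  interpret group "raag V E" by (rule group_raag)
  show ?thesis
    using assms gen_closed[OF assms(1), of E] gen_closed[OF assms(2), of E]
      int_pow_commute[OF _ _ int_pow_commute[OF _ _ gen_commute[OF assms], of e, symmetric], of e']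
    by (subst raag_class_eq_iff[symmetric])
      (simp_all add: class_syll flip: raag_mult del: Image_singleton_iff)
qed

lemma magnus_syll:
  assumes "f \<in> square_free_funs E"
  shows "foldr magnus (syll x e) f t = f t + e * f (t @ [x])"
proof -
  have "foldr magnus (replicate n (x, b)) f t = f t + int n * sg b * f (t @ [x])" for n b t
  proof (induction n arbitrary: t)
    case (Suc n)
    have "foldr magnus (replicate (Suc n) (x, b)) f t
      = foldr magnus (replicate n (x, b)) f t + sg b * foldr magnus (replicate n (x, b)) f (t @ [x])"
      by (simp add: magnus_def)
    also have "\<dots> = f t + int n * sg b * f (t @ [x]) + sg b * (f (t @ [x]) + int n * sg b * f (t @ [x, x]))"
      by (simp only: Suc append_assoc append.simps)
    finally show ?case
      using square_free_funs_square[OF assms, of t x "[]"] by (simp add: algebra_simps)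
  qed simp
  then show ?thesis by (simp add: syll_def)
qed

text \<open>
  The product of the \<open>1 + e x\<close> over the syllables has the product of all \<open>e x\<close> as its only term
  of degree \<open>length s\<close>; the terms of lower degree contribute values of \<open>f\<close> at lists shorter than
  \<open>k\<close>.
\<close>

lemma magnus_syll_word:
  assumes "f \<in> square_free_funs E" "\<And>t. length t < k \<Longrightarrow> f t = 0" "length t + length s \<le> k"
  shows "foldr magnus (syll_word s) f t = prod_list (map snd s) * f (t @ map fst s)"
  using assms(3)
proof (induction s arbitrary: t)
  case (Cons a s)
  have "foldr magnus (syll_word (a # s)) f t = foldr magnus (syll_word s) f t
      + snd a * foldr magnus (syll_word s) f (t @ [fst a])"
    using magnus_syll[OF foldr_magnus_stable[OF assms(1)]] by simp
  then show ?case using Cons by (simp add: assms(2))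
qed simp

lemma ex_syll_word:
  assumes "u \<in> words X"
  shows "\<exists>s. u = syll_word s \<and> fst ` set s \<subseteq> X"
  using assms
proof (induction u)
  case Nil show ?case by (auto intro!: exI[of _ "[]"])
next
  case (Cons a u)
  obtain x b where a: "a = (x, b)" by (cases a)
  from Cons a obtain s where "u = syll_word s" "fst ` set s \<subseteq> X" by auto
  then show ?case
    using Cons.prems a by (intro exI[of _ "(x, sg b) # s"]) (auto simp: syll_def)
qed

text \<open>
  Write \<open>u\<close> with as few syllables as possible, and let \<open>f\<close> be the indicator function of all
  vertex sequences of such shortest expressions. Commuting two adjacent syllables of a shortest
  expression gives another one. Two neighbouring syllables never have the same vertex, since they
  could be merged. So \<open>f\<close> is one of the functions acted upon, without any theory of normal forms.
  At the empty list \<open>u\<close> turns \<open>f\<close> into the product of the exponents, which are nonzero by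
  minimality; if \<open>u\<close> fixes \<open>f\<close>, then \<open>f [] \<noteq> 0\<close>, so the shortest expression is empty.
\<close>

lemma magnus_faithful:
  assumes u: "u \<in> words V"
    and id: "\<And>f d. f \<in> square_free_funs E \<Longrightarrow> (\<And>t. length t \<ge> d \<Longrightarrow> f t = 0) \<Longrightarrow> foldr magnus u f = f"
  shows "(u, []) \<in> raag_rel V E"
proof -
  define P where "P s \<longleftrightarrow> fst ` set s \<subseteq> V \<and> (u, syll_word s) \<in> raag_rel V E" for s
  obtain s0 where "P s0"
    using ex_syll_word[OF u] u by (auto simp: P_def intro: pres_rel.refl)
  then obtain s where s: "P s" and min: "\<And>s'. P s' \<Longrightarrow> length s \<le> length s'"
    using ex_has_least_nat[of P s0 length] by blast
  have replace: "P (p @ r' @ q)"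
    if "P (p @ r @ q)" "(syll_word r, syll_word r') \<in> raag_rel V E" "fst ` set r' \<subseteq> V" for p q r r'
  proof -
    have "(syll_word p @ syll_word r @ syll_word q, syll_word p @ syll_word r' @ syll_word q) \<in> raag_rel V E"
      using that by (intro pres_rel_context) (auto simp: P_def image_Un)
    then show ?thesis
      using that by (auto simp: P_def intro: pres_rel.trans)
  qed
  define f where "f t = (of_bool (\<exists>s'. P s' \<and> length s' = length s \<and> map fst s' = t) :: int)" for t
  have swap: "f (p @ [x, y] @ q) \<le> f (p @ [y, x] @ q)" if "{x, y} \<in> E" for p q x y
  proof (cases "\<exists>s'. P s' \<and> length s' = length s \<and> map fst s' = p @ [x, y] @ q")
    case True
    then obtain p' q' d e where s': "P (p' @ [(x, d), (y, e)] @ q')"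
      "length (p' @ [(x, d), (y, e)] @ q') = length s" "map fst p' = p" "map fst q' = q"
      by (auto simp: map_eq_append_conv map_eq_Cons_conv)
    then have "x \<in> V" "y \<in> V" by (auto simp: P_def)
    then have "P (p' @ [(y, e), (x, d)] @ q')"
      by (intro replace[OF s'(1)]) (auto intro: syll_commute that)
    then have "f (p @ [y, x] @ q) = 1"
      using s' by (auto simp: f_def intro!: exI[of _ "p' @ [(y, e), (x, d)] @ q'"])
    then show ?thesis by (simp add: f_def)
  next
    case False
    then have "f (p @ [x, y] @ q) = 0" unfolding f_def by (simp only: of_bool_def if_False)
    moreover have "0 \<le> f (p @ [y, x] @ q)" by (simp add: f_def)
    ultimately show ?thesis by (simp only:)
  qed
  have square: "f (p @ [x, x] @ q) = 0" for p q x
  proof (rule ccontr)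
    assume "f (p @ [x, x] @ q) \<noteq> 0"
    then obtain p' q' d e where s': "P (p' @ [(x, d), (x, e)] @ q')"
      "length (p' @ [(x, d), (x, e)] @ q') = length s"
      by (auto simp: f_def map_eq_append_conv map_eq_Cons_conv)
    then have "x \<in> V" by (auto simp: P_def)
    then have "P (p' @ [(x, d + e)] @ q')"
      by (intro replace[OF s'(1)]) (auto intro: syll_merge)
    from min[OF this] s'(2) show False by simp
  qed
  have f: "f \<in> square_free_funs E"
  proof (rule square_free_funsI)
    fix p q :: "'a list" and x y assume "{x, y} \<in> E"
    moreover from this have "{y, x} \<in> E" by (simp only: insert_commute)
    ultimately show "f (p @ x # y # q) = f (p @ y # x # q)"
      using swap[of x y p q] swap[of y x p q] by simp
  qed (use square in simp)
  have nonzero: "e \<noteq> 0" if "(x, e) \<in> set s" for x e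
  proof
    assume "e = 0"
    with that obtain p q where pq: "s = p @ [(x, 0)] @ q" by (auto dest: split_list)
    have "P (p @ [] @ q)"
      by (rule replace[of p "[(x, 0)]" q]) (use s in \<open>auto simp: pq syll_def intro: pres_rel.refl\<close>)
    from min[OF this] pq show False by simp
  qed
  have "f t = 0" if "length t \<noteq> length s" for t using that by (auto simp: f_def)
  then have "foldr magnus u f = f"
    by (intro id[of f "Suc (length s)"] f) auto
  moreover have "foldr magnus u f = foldr magnus (syll_word s) f"
    using s f by (intro foldr_magnus_raag_rel) (auto simp: P_def)
  moreover have "foldr magnus (syll_word s) f [] = prod_list (map snd s) * f ([] @ map fst s)"
    by (rule magnus_syll_word[OF f, of "length s"]) (auto simp: f_def)
  moreover have "f (map fst s) = 1" using s by (auto simp: f_def)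
  moreover have "prod_list (map snd s) \<noteq> 0" using nonzero by (auto simp: prod_list_zero_iff)
  ultimately have "f [] \<noteq> 0" by simp
  then have "s = []" by (auto simp: f_def split: if_splits)
  then show ?thesis using s by (simp add: P_def)
qed

text \<open>
  Equal powers act equally, so the elements themselves act equally on finitely supported functions,
  and on those the action is faithful.
\<close>

lemma raag_unique_roots:
  assumes a: "a \<in> carrier (raag V E)" and b: "b \<in> carrier (raag V E)" and m: "m > 0"
    and eq: "a [^]\<^bsub>raag V E\<^esub> (m :: nat) = b [^]\<^bsub>raag V E\<^esub> m"
  shows "a = b"
proof -
  interpret group "raag V E" by (rule group_raag)
  obtain u v where u: "u \<in> words V" "a = raag_rel V E `` {u}" and v: "v \<in> words V" "b = raag_rel V E `` {v}"
    using a b by (auto simp: raag_carrier)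
  have pow: "raag_rel V E `` {w} [^]\<^bsub>raag V E\<^esub> n = raag_rel V E `` {concat (replicate n w)}
      \<and> concat (replicate n w) \<in> words V" if "w \<in> words V" for w and n :: nat
  proof (induction n)
    case (Suc n)
    have "concat (replicate n w) @ w = w @ concat (replicate n w)"
      by (induction n) auto
    then show ?case using Suc that by (auto simp: raag_mult simp del: Image_singleton_iff)
  qed (simp add: raag_one)
  have rel: "(concat (replicate m u), concat (replicate m v)) \<in> raag_rel V E"
    using eq pow[of u m] pow[of v m] u v by (simp add: raag_class_eq_iff del: Image_singleton_iff)
  have foldr_pow: "foldr magnus (concat (replicate n w)) f = (foldr magnus w ^^ n) f" for n and w :: "'a word" and f
    by (induction n) auto
  have same: "foldr magnus u f = foldr magnus v f"
    if "f \<in> square_free_funs E" "\<And>t. length t \<ge> d \<Longrightarrow> f t = 0" for f d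
    using m _ that
  proof (rule foldr_magnus_unique_root)
    show "(foldr magnus u ^^ m) g = (foldr magnus v ^^ m) g" if "g \<in> square_free_funs E" for g
      using foldr_magnus_raag_rel[OF rel that] by (simp add: foldr_pow)
  qed auto
  obtain v' where v': "v' \<in> words V" "(v' @ v, []) \<in> raag_rel V E"
    using pres_rel_inverse v(1) by blast
  have "(v' @ u, []) \<in> raag_rel V E"
  proof (rule magnus_faithful)
    fix f and d :: nat
    assume f: "f \<in> square_free_funs E" "\<And>t. length t \<ge> d \<Longrightarrow> f t = 0"
    show "foldr magnus (v' @ u) f = f"
      using foldr_magnus_raag_rel[OF v'(2) f(1)] same[OF f] by simp
  qed (use u v' in simp)
  then have "(v' @ u, v' @ v) \<in> raag_rel V E"
    using v'(2) by (blast intro: pres_rel.trans pres_rel.sym)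
  then have "raag_rel V E `` {v'} \<otimes>\<^bsub>raag V E\<^esub> a = raag_rel V E `` {v'} \<otimes>\<^bsub>raag V E\<^esub> b"
    using u v v'(1) pres_rel_class_eq by (simp add: raag_mult del: Image_singleton_iff)
  moreover have "raag_rel V E `` {v'} \<in> carrier (raag V E)"
    using v'(1) unfolding raag_carrier by blast
  ultimately show ?thesis using a b by simp
qed


section \<open>Exponent sums\<close>

definition exponent_sum :: "'a \<Rightarrow> 'a word \<Rightarrow> int" where
  "exponent_sum w u = (\<Sum>(x, b)\<leftarrow>u. if x = w then sg b else 0)"

lemma exponent_sum_raag_rel:
  "(u, v) \<in> raag_rel V E \<Longrightarrow> exponent_sum w u = exponent_sum w v"
  by (induction rule: pres_rel.induct) (auto simp: exponent_sum_def)

definition exponent :: "'a \<Rightarrow> 'a word set \<Rightarrow> int" where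
  "exponent w A = exponent_sum w (SOME u. u \<in> A)"

lemma exponent_class:
  assumes "u \<in> words V"
  shows "exponent w (raag_rel V E `` {u}) = exponent_sum w u"
proof -
  have "u \<in> raag_rel V E `` {u}"
    using assms by (simp add: pres_rel.refl)
  then have "(SOME v. v \<in> raag_rel V E `` {u}) \<in> raag_rel V E `` {u}"
    by (rule someI)
  then have "(u, SOME v. v \<in> raag_rel V E `` {u}) \<in> raag_rel V E"
    by blast
  from exponent_sum_raag_rel[OF this] show ?thesis
    by (simp add: exponent_def)
qed

lemma exponent_mult:
  assumes "A \<in> carrier (raag V E)" "B \<in> carrier (raag V E)"
  shows "exponent w (A \<otimes>\<^bsub>raag V E\<^esub> B) = exponent w A + exponent w B"
proof -
  obtain u v where "u \<in> words V" "A = raag_rel V E `` {u}" "v \<in> words V" "B = raag_rel V E `` {v}"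
    using assms by (auto simp: raag_carrier)
  then show ?thesis
    by (simp add: raag_mult exponent_class exponent_sum_def del: Image_singleton_iff)
qed

lemma exponent_gen: "w \<in> V \<Longrightarrow> exponent w (gen V E w) = 1"
  unfolding gen_def by (subst exponent_class) (simp_all add: exponent_sum_def)

text \<open>
  The integral Heisenberg group, as a group of affine maps of the plane: \<open>v\<close> acts by a shear and
  \<open>w\<close> by a translation.
\<close>

fun heisenberg :: "'a \<Rightarrow> 'a \<Rightarrow> 'a \<times> bool \<Rightarrow> int \<times> int \<Rightarrow> int \<times> int" where
  "heisenberg v w (x, b) (p, q) =
    (if x = v then (p, q + sg b * p) else if x = w then (p + sg b, q) else (p, q))"

lemma heisenberg_raag_rel:
  assumes "(u, u') \<in> raag_rel V E" "{v, w} \<notin> E"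
  shows "foldr (heisenberg v w) u s = foldr (heisenberg v w) u' s"
proof (rule foldr_pres_rel[OF assms(1), where S = UNIV])
  fix x b and s :: "int \<times> int"
  show "heisenberg v w (x, b) (heisenberg v w (x, \<not> b) s) = s"
    by (cases s) auto
next
  fix l r :: "'a word" and s :: "int \<times> int"
  assume "(l, r) \<in> {([(v, True), (w, True)], [(w, True), (v, True)]) | v w. {v, w} \<in> E}"
  then obtain x y where lr: "l = [(x, True), (y, True)]" "r = [(y, True), (x, True)]" and "{x, y} \<in> E"
    by blast
  then have "\<not> (x = v \<and> y = w)" "\<not> (x = w \<and> y = v)"
    using assms(2) by (auto simp: insert_commute)
  then show "foldr (heisenberg v w) l s = foldr (heisenberg v w) r s"
    unfolding lr by (cases s) auto
qed auto

lemma fst_foldr_heisenberg: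
  assumes "v \<noteq> w"
  shows "fst (foldr (heisenberg v w) u s) = fst s + exponent_sum w u"
proof (induction u)
  case (Cons a u)
  obtain p q where "foldr (heisenberg v w) u s = (p, q)" by fastforce
  with Cons assms show ?case by (cases a) (auto simp: exponent_sum_def)
qed (simp add: exponent_sum_def)

text \<open>
  In the Heisenberg group, commuting with \<open>v\<close> forces the exponent sum of \<open>w\<close> to vanish: the shear
  \<open>v\<close> fixes the origin, and changes its image \<open>(e, k)\<close> under \<open>c\<close> by \<open>e\<close>.
\<close>

lemma exponent_center:
  assumes c: "c \<in> center (raag V E)" and "v \<in> V" "v \<noteq> w" "{v, w} \<notin> E"
  shows "exponent w c = 0"
proof -
  obtain u where u: "u \<in> words V" "c = raag_rel V E `` {u}"
    using c by (auto simp: center_def raag_carrier)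
  have "c \<otimes>\<^bsub>raag V E\<^esub> gen V E v = gen V E v \<otimes>\<^bsub>raag V E\<^esub> c"
    using c gen_closed[OF \<open>v \<in> V\<close>] by (simp add: center_def)
  then have "(u @ [(v, True)], [(v, True)] @ u) \<in> raag_rel V E"
    using u \<open>v \<in> V\<close> unfolding gen_def
    by (subst raag_class_eq_iff[symmetric]) (simp_all add: raag_mult del: Image_singleton_iff)
  from heisenberg_raag_rel[OF this \<open>{v, w} \<notin> E\<close>, of "(0, 0)"]
  have "foldr (heisenberg v w) u (0, 0) = heisenberg v w (v, True) (foldr (heisenberg v w) u (0, 0))"
    by simp
  then have "fst (foldr (heisenberg v w) u (0, 0)) = 0"
    by (cases "foldr (heisenberg v w) u (0, 0)") simp
  then show ?thesis
    using u fst_foldr_heisenberg[OF \<open>v \<noteq> w\<close>, of u "(0, 0)"]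
    by (simp add: exponent_class del: Image_singleton_iff)
qed


section \<open>Cliques\<close>

lemma words_commute:
  assumes letters: "\<And>a b. a \<in> V \<times> UNIV \<Longrightarrow> b \<in> V \<times> UNIV \<Longrightarrow> ([a, b], [b, a]) \<in> pres_rel V R"
    and "u \<in> words V" and v: "v \<in> words V"
  shows "(u @ v, v @ u) \<in> pres_rel V R"
proof -
  have letter: "(a # v, v @ [a]) \<in> pres_rel V R" if a: "a \<in> V \<times> UNIV" for a
    using v
  proof (induction v)
    case Nil
    show ?case using a by (auto intro!: pres_rel.refl)
  next
    case (Cons b v)
    then have b: "b \<in> V \<times> UNIV" and v: "v \<in> words V" by (auto simp: words_def)
    have "([] @ [a, b] @ v, [] @ [b, a] @ v) \<in> pres_rel V R"
      using letters[OF a b] v by (intro pres_rel_context) auto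
    moreover have "([b] @ (a # v) @ [], [b] @ (v @ [a]) @ []) \<in> pres_rel V R"
      using b by (intro pres_rel_context Cons.IH v) auto
    ultimately show ?case by (auto intro: pres_rel.trans)
  qed
  show ?thesis
    using \<open>u \<in> words V\<close>
  proof (induction u)
    case Nil
    show ?case using v by (simp add: pres_rel.refl)
  next
    case (Cons a u)
    then have a: "a \<in> V \<times> UNIV" and u: "u \<in> words V" by (auto simp: words_def)
    have "([a] @ (u @ v) @ [], [a] @ (v @ u) @ []) \<in> pres_rel V R"
      using a by (intro pres_rel_context Cons.IH u) auto
    moreover have "([] @ (a # v) @ u, [] @ (v @ [a]) @ u) \<in> pres_rel V R"
      using u by (intro pres_rel_context letter a) auto
    ultimately show ?case by (auto intro: pres_rel.trans)
  qed
qed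

lemma comm_group_raag_clique:
  assumes "clique V E"
  shows "comm_group (raag V E)"
proof -
  interpret group "raag V E" by (rule group_raag)
  have letters: "([a, b], [b, a]) \<in> raag_rel V E" if "a \<in> V \<times> UNIV" "b \<in> V \<times> UNIV" for a b
  proof -
    obtain x i y j where ab: "a = (x, i)" "b = (y, j)" by (cases a, cases b)
    have xy: "x \<in> V" "y \<in> V" using that ab by auto
    have "(syll x (sg i) @ syll y (sg j), syll y (sg j) @ syll x (sg i)) \<in> raag_rel V E"
    proof (cases "x = y")
      case True
      have "(syll x (sg j) @ syll x (sg i), syll x (sg i + sg j)) \<in> raag_rel V E"
        by (subst add.commute) (rule syll_merge[OF xy(1)])
      from pres_rel.trans[OF syll_merge[OF xy(1)] pres_rel.sym[OF this]] show ?thesis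
        unfolding True[symmetric] .
    next
      case False
      then show ?thesis
        using assms xy by (intro syll_commute) (auto simp: clique_def)
    qed
    then show ?thesis by (simp add: ab syll_def split: if_splits)
  qed
  show ?thesis
  proof (rule group_comm_groupI)
    fix A B assume "A \<in> carrier (raag V E)" "B \<in> carrier (raag V E)"
    then obtain u v where "u \<in> words V" "A = raag_rel V E `` {u}" "v \<in> words V" "B = raag_rel V E `` {v}"
      by (auto simp: raag_carrier)
    moreover from this have "(u @ v, v @ u) \<in> raag_rel V E"
      by (intro words_commute letters)
    ultimately show "A \<otimes>\<^bsub>raag V E\<^esub> B = B \<otimes>\<^bsub>raag V E\<^esub> A"
      using pres_rel_class_eq[of "u @ v" "v @ u" V] by (simp only: raag_mult)
  qed
qed


section \<open>The characterisation\<close>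

theorem corollaryC:
  fixes V :: "'a set" and E :: "'a set set"
  assumes "finite V" and "V \<noteq> {}" and "E \<subseteq> [V]\<^bsup>2\<^esup>"
  shows "(\<exists>N. N \<lhd> AutoGroup (raag V E) \<and> finite N \<and> N \<noteq> {\<one>\<^bsub>AutoGroup (raag V E)\<^esub>})
    \<longleftrightarrow> clique V E"
proof
  assume "\<exists>N. N \<lhd> AutoGroup (raag V E) \<and> finite N \<and> N \<noteq> {\<one>\<^bsub>AutoGroup (raag V E)\<^esub>}"
  then obtain N where N: "N \<lhd> AutoGroup (raag V E)" "finite N" "N \<noteq> {\<one>\<^bsub>AutoGroup (raag V E)\<^esub>}"
    by blast
  show "clique V E"
  proof (rule ccontr)
    assume "\<not> clique V E"
    then obtain v w where vw: "v \<in> V" "w \<in> V" "v \<noteq> w" "{v, w} \<notin> E"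
      by (auto simp: clique_def)
    interpret group "raag V E" by (rule group_raag)
    have "N = {\<one>\<^bsub>AutoGroup (raag V E)\<^esub>}"
    proof (rule no_finite_normal_subgroup_AutoGroup[where \<epsilon> = "exponent w" and w = "gen V E w"])
      show "a = b" if "a \<in> carrier (raag V E)" "b \<in> carrier (raag V E)" "m > 0"
        "a [^]\<^bsub>raag V E\<^esub> m = b [^]\<^bsub>raag V E\<^esub> m" for a b and m :: nat
        using that by (rule raag_unique_roots)
    qed (use vw N in \<open>auto simp: exponent_mult exponent_gen gen_closed intro: exponent_center\<close>)
    with N show False by blast
  qed
next
  assume "clique V E"
  then interpret comm_group "raag V E" by (rule comm_group_raag_clique)
  obtain v where v: "v \<in> V" using \<open>V \<noteq> {}\<close> by blast
  have g: "gen V E v \<in> carrier (raag V E)" using v by (rule gen_closed)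
  have "exponent v \<one>\<^bsub>raag V E\<^esub> = 0"
    by (simp add: raag_one exponent_class exponent_sum_def del: Image_singleton_iff)
  then have "exponent v (inv\<^bsub>raag V E\<^esub> gen V E v) + exponent v (gen V E v) = 0"
    using exponent_mult[of "inv\<^bsub>raag V E\<^esub> gen V E v" V E "gen V E v" v] g by simp
  then have "inv\<^bsub>raag V E\<^esub> gen V E v \<noteq> gen V E v"
    using exponent_gen[OF v, of E] by auto
  with g show "\<exists>N. N \<lhd> AutoGroup (raag V E) \<and> finite N \<and> N \<noteq> {\<one>\<^bsub>AutoGroup (raag V E)\<^esub>}"
    by (rule inversion_normal_AutoGroup)
qed

end
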